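(* Let $m\ge 2$ be an integer and let $u$ be a real function which is $m$ times continuously differentiable in a neighbourhood $D\subset\mathbb{R}$ of an isolated fixed point $x^*$ of $u$, with $$u(x^* )=x^*,\qquad u'(x^* )=1,\qquad u^{(j)}(x^* )=0\ \text{ for } 2\le j\le m-1,\qquad u^{(m)}(x^* )\neq 0 .$$ Define, near $x^*$, $$v(x)=\begin{cases}\dfrac{u(x)-x\,u'(x)}{1-u'(x)}, & x\neq x^*,\\[2mm] x^*, & x=x^*,\end{cases}\qquad\qquad w(x)=\frac{v(x)-x\,v'(x)}{1-v'(x)} .$$ Then $u$ belongs to the kernel of $w$ if and only if $v$ is the linear function $$v(x)=(1-v'(x^* ))\,x^*+v'(x^* )\,x$$ for $x$ belonging to a neighbourhood of $x^*$.
   Context: The function $u$ is said to belong to the kernel of $w$ (where $w$ is built from $u$ as in the statement) if $w$ is the constant function $w(x)=x^*$ for all $x$ in a neighbourhood of $x^*$. *)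

theory Defs
  imports "HOL-Analysis.Analysis"
begin

definition continuously_differentiable_on ::
    "nat \<Rightarrow> (real \<Rightarrow> real) \<Rightarrow> real set \<Rightarrow> bool" where
  "continuously_differentiable_on m f D \<longleftrightarrow>
     (\<forall>j<m. \<forall>x\<in>D. (deriv ^^ j) f field_differentiable at x) \<and>
     continuous_on D ((deriv ^^ m) f)"

text \<open>The functions below are total on the reals, but only their values near the fixed point
  matter: there (away from the fixed point itself, for the first one) the denominators are nonzero
  under the hypotheses of the theorem, so division by zero plays no role.\<close>

definition v_fun :: "(real \<Rightarrow> real) \<Rightarrow> real \<Rightarrow> real \<Rightarrow> real" where
  "v_fun u xs x = (if x = xs then xs else (u x - x * deriv u x) / (1 - deriv u x))"

definition w_fun :: "(real \<Rightarrow> real) \<Rightarrow> real \<Rightarrow> real \<Rightarrow> real" where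
  "w_fun u xs x =
     (v_fun u xs x - x * deriv (v_fun u xs) x) / (1 - deriv (v_fun u xs) x)"

definition in_kernel_w :: "(real \<Rightarrow> real) \<Rightarrow> real \<Rightarrow> bool" where
  "in_kernel_w u xs \<longleftrightarrow> (\<forall>\<^sub>F x in nhds xs. w_fun u xs x = xs)"

end

theory Submission
  imports Defs
begin

text \<open>With \<open>f x = u x - x\<close>, the function \<open>v\<close> is the Newton map \<open>x - f x / f' x\<close> of \<open>f\<close>, which has
  a zero of exact order \<open>m\<close> at \<open>x\<^sup>*\<close>. Hence \<open>v\<close> is differentiable at \<open>x\<^sup>*\<close> with derivative
  \<open>1 - 1 / m\<close>, and \<open>v' = f f'' / f'\<^sup>2\<close> tends to the same value, so \<open>1 - v'\<close> does not vanish near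
  \<open>x\<^sup>*\<close>. Therefore \<open>w x = x\<^sup>*\<close> means \<open>v x - x\<^sup>* = (x - x\<^sup>*) v' x\<close>, i.e. the quotient
  \<open>(v x - x\<^sup>*) / (x - x\<^sup>*)\<close> has derivative zero on both sides of \<open>x\<^sup>*\<close>; as it has a limit at
  \<open>x\<^sup>*\<close>, both constants agree with \<open>v' x\<^sup>*\<close>.\<close>

text \<open>One L'Hopital step: the leading term of \<open>g'\<close> at \<open>a\<close> integrates
  to that of \<open>g\<close>. It serves to climb from u'' to u' - 1 and then to u - x.\<close>

lemma tendsto_div_power_Suc:
  fixes g g' :: "real \<Rightarrow> real"
  assumes der: "\<forall>\<^sub>F x in at a. (g has_real_derivative g' x) (at x)"
    and "isCont g a" and "g a = 0"
    and lim: "((\<lambda>x. g' x / (x - a) ^ n) \<longlongrightarrow> L) (at a)"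
  shows "((\<lambda>x. g x / (x - a) ^ Suc n) \<longlongrightarrow> L / real (Suc n)) (at a)"
proof (rule lhopital[where f' = g' and g' = "\<lambda>x. real (Suc n) * (x - a) ^ n"])
  show "(g \<longlongrightarrow> 0) (at a)"
    using assms(2,3) by (metis isCont_def)
  show "((\<lambda>x. (x - a) ^ Suc n) \<longlongrightarrow> 0) (at a)"
    by (rule tendsto_eq_intros refl | simp)+
  have ne: "\<forall>\<^sub>F x in at a. x \<noteq> a"
    by (simp add: eventually_at_filter)
  show "\<forall>\<^sub>F x in at a. (x - a) ^ Suc n \<noteq> 0" "\<forall>\<^sub>F x in at a. real (Suc n) * (x - a) ^ n \<noteq> 0"
    using ne by (eventually_elim, simp)+
  show "\<forall>\<^sub>F x in at a. ((\<lambda>x. (x - a) ^ Suc n) has_real_derivative real (Suc n) * (x - a) ^ n) (at x)"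
    by (intro always_eventually allI) (rule derivative_eq_intros refl | simp)+
  show "((\<lambda>x. g' x / (real (Suc n) * (x - a) ^ n)) \<longlongrightarrow> L / real (Suc n)) (at a)"
    using tendsto_divide[OF lim tendsto_const, of "real (Suc n)"] by (simp add: mult.commute)
qed (rule der)

text \<open>Taylor's theorem in Peano form at a zero. The induction peels off the innermost
  derivative, so that the hypothesis applies to \<open>deriv g\<close> and one L'Hopital step
  returns to \<open>g\<close>.\<close>

lemma tendsto_div_power_iterated_deriv:
  fixes g :: "real \<Rightarrow> real"
  assumes "open D" "a \<in> D"
    and "\<forall>j<n. \<forall>x\<in>D. (deriv ^^ j) g field_differentiable at x"
    and "isCont ((deriv ^^ n) g) a"
    and "\<forall>j<n. (deriv ^^ j) g a = 0"
  shows "((\<lambda>x. g x / (x - a) ^ n) \<longlongrightarrow> (deriv ^^ n) g a / fact n) (at a)"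
  using assms(3-)
proof (induction n arbitrary: g)
  case 0
  then show ?case by (simp add: isCont_def)
next
  case (Suc n)
  have diff: "g field_differentiable at x" if "x \<in> D" for x
    using Suc.prems(1) that by fastforce
  have "((\<lambda>x. deriv g x / (x - a) ^ n) \<longlongrightarrow> (deriv ^^ n) (deriv g) a / fact n) (at a)"
  proof (rule Suc.IH)
    show "\<forall>j<n. \<forall>x\<in>D. (deriv ^^ j) (deriv g) field_differentiable at x"
      using Suc.prems(1) by (metis Suc_less_eq comp_apply funpow_Suc_right)
    show "isCont ((deriv ^^ n) (deriv g)) a"
      using Suc.prems(2) by (simp add: funpow_swap1)
    show "\<forall>j<n. (deriv ^^ j) (deriv g) a = 0"
      using Suc.prems(3) by (metis Suc_less_eq comp_apply funpow_Suc_right)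
  qed
  moreover have "\<forall>\<^sub>F x in at a. (g has_real_derivative deriv g x) (at x)"
    using eventually_at_in_open'[OF assms(1,2)]
    by eventually_elim (simp add: diff field_differentiable_derivI)
  moreover have "isCont g a"
    using diff assms(2) field_differentiable_imp_continuous_at by blast
  moreover have "g a = 0"
    using Suc.prems(3) by fastforce
  ultimately have "((\<lambda>x. g x / (x - a) ^ Suc n) \<longlongrightarrow>
      ((deriv ^^ n) (deriv g) a / fact n) / real (Suc n)) (at a)"
    by (intro tendsto_div_power_Suc)
  then show ?case
    by (simp add: funpow_swap1 mult.commute)
qed

text \<open>A zero derivative off \<open>a\<close> gives one constant per side. Filling in the limit
  \<open>L\<close> at \<open>a\<close> makes the function continuous on a ball, and a single
  exceptional point does not spoil constancy there.\<close>

lemma eventually_const_if_deriv_zero: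
  fixes f :: "real \<Rightarrow> real"
  assumes der: "\<forall>\<^sub>F x in at a. (f has_real_derivative 0) (at x)"
    and lim: "(f \<longlongrightarrow> L) (at a)"
  shows "\<forall>\<^sub>F x in at a. f x = L"
proof -
  obtain d where "d > 0" and d: "\<And>x. x \<noteq> a \<Longrightarrow> dist x a < d \<Longrightarrow> (f has_real_derivative 0) (at x)"
    using der unfolding eventually_at by auto
  define h where "h = (\<lambda>x. if x = a then L else f x)"
  have h_der: "(h has_real_derivative 0) (at x)" if "x \<noteq> a" "dist x a < d" for x
    by (rule has_field_derivative_transform_within_open[OF d[OF that], of "- {a}"])
      (use that in \<open>auto simp: h_def\<close>)
  have "(h \<longlongrightarrow> L) (at a)"
    using lim by (rule Lim_transform_eventually) (simp add: h_def eventually_at_filter)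
  then have cont_a: "isCont h a"
    by (simp add: isCont_def h_def)
  have cont: "continuous_on (ball a d) h"
    by (metis DERIV_isCont cont_a continuous_at_imp_continuous_on dist_commute h_der mem_ball)
  have "h x = L" if "x \<in> ball a d" for x
  proof (rule has_derivative_zero_unique_strong_convex[of "ball a d" "{a}" h a])
    show "(h has_derivative (\<lambda>h. 0)) (at y within ball a d)" if "y \<in> ball a d - {a}" for y
    proof -
      have "(h has_real_derivative 0) (at y within ball a d)"
        using h_der[of y] that by (auto simp: dist_commute intro: has_field_derivative_at_within)
      then show ?thesis
        by (simp add: has_field_derivative_def lambda_zero)
    qed
  qed (use that cont \<open>d > 0\<close> in \<open>auto simp: h_def\<close>)
  then show ?thesis
    unfolding eventually_at using \<open>d > 0\<close> by (metis dist_commute h_def mem_ball)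
qed

text \<open>In the quotient rule the terms x u' u'' cancel, leaving (u - x) u'' in the numerator.
  The case distinction at \<open>a\<close> is invisible on the open complement of
  \<open>a\<close>.\<close>

lemma v_fun_has_derivative_off:
  assumes "x \<noteq> a" "u field_differentiable at x" "deriv u field_differentiable at x" "deriv u x \<noteq> 1"
  shows "(v_fun u a has_real_derivative
           (u x - x) * deriv (deriv u) x / (deriv u x - 1) ^ 2) (at x)"
proof -
  have [derivative_intros]: "(u has_real_derivative deriv u x) (at x)"
    "(deriv u has_real_derivative deriv (deriv u) x) (at x)"
    using assms by (simp_all add: field_differentiable_derivI)
  have "((\<lambda>x. (u x - x * deriv u x) / (1 - deriv u x)) has_real_derivative
           (u x - x) * deriv (deriv u) x / (deriv u x - 1) ^ 2) (at x)"
    using assms(4)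
    by (auto intro!: derivative_eq_intros simp: field_simps power2_eq_square)
  then show ?thesis
    by (rule has_field_derivative_transform_within_open[of _ _ _ "- {a}"])
      (use assms(1) in \<open>auto simp: v_fun_def\<close>)
qed

lemma w_fun_eq_iff:
  assumes "deriv (v_fun u a) x \<noteq> 1"
  shows "w_fun u a x = a \<longleftrightarrow> v_fun u a x - a = (x - a) * deriv (v_fun u a) x"
  using assms by (auto simp: w_fun_def divide_simps algebra_simps)

text \<open>All that is used about the zero of f = u - x at \<open>a\<close> are the leading terms
  of f, f' and f'', of orders n + 2, n + 1 and n; here m = n + 2.\<close>

lemma kernel_iff_v_affine:
  fixes u :: "real \<Rightarrow> real"
  assumes der: "\<forall>\<^sub>F x in at a. u field_differentiable at x"
      "\<forall>\<^sub>F x in at a. deriv u field_differentiable at x"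
    and lim0: "((\<lambda>x. (u x - x) / (x - a) ^ Suc (Suc n)) \<longlongrightarrow>
                 L / real (Suc n) / real (Suc (Suc n))) (at a)"
    and lim1: "((\<lambda>x. (deriv u x - 1) / (x - a) ^ Suc n) \<longlongrightarrow> L / real (Suc n)) (at a)"
    and lim2: "((\<lambda>x. deriv (deriv u) x / (x - a) ^ n) \<longlongrightarrow> L) (at a)"
    and "L \<noteq> 0"
  shows "in_kernel_w u a \<longleftrightarrow>
    (\<forall>\<^sub>F x in nhds a. v_fun u a x = (1 - deriv (v_fun u a) a) * a + deriv (v_fun u a) a * x)"
proof -
  \<comment> \<open>This is 1 - 1/m, the value of v' at \<open>a\<close> and also its limit
    there.\<close>
  define p where "p = real (Suc n) / real (Suc (Suc n))"
  define v where "v = v_fun u a"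
  have "p \<noteq> 1" by (simp add: p_def)
  have ne: "\<forall>\<^sub>F x in at a. x \<noteq> a"
    by (simp add: eventually_at_filter)
  have du: "\<forall>\<^sub>F x in at a. deriv u x \<noteq> 1"
    using tendsto_imp_eventually_ne[OF lim1, of 0] \<open>L \<noteq> 0\<close>
    by (auto elim!: eventually_mono)

  have v_off: "v x - a = (x - a) - (u x - x) / (deriv u x - 1)" if "x \<noteq> a" "deriv u x \<noteq> 1" for x
    using that by (simp add: v_def v_fun_def divide_simps) (simp add: algebra_simps)
  \<comment> \<open>Dividing f and f' by their own powers of x - a leaves exactly one factor x - a,
    the denominator of the difference quotient of \<open>v\<close> at \<open>a\<close>.\<close>
  have "((\<lambda>x. 1 - ((u x - x) / (x - a) ^ Suc (Suc n)) / ((deriv u x - 1) / (x - a) ^ Suc n))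
      \<longlongrightarrow> 1 - L / real (Suc n) / real (Suc (Suc n)) / (L / real (Suc n))) (at a)"
    by (intro tendsto_intros lim0 lim1) (use \<open>L \<noteq> 0\<close> in simp)
  also have "1 - L / real (Suc n) / real (Suc (Suc n)) / (L / real (Suc n)) = p"
    using \<open>L \<noteq> 0\<close> by (simp add: p_def divide_simps del: of_nat_Suc)
  finally have quot: "((\<lambda>x. (v x - a) / (x - a)) \<longlongrightarrow> p) (at a)"
  proof (rule Lim_transform_eventually)
    show "\<forall>\<^sub>F x in at a. 1 - ((u x - x) / (x - a) ^ Suc (Suc n)) / ((deriv u x - 1) / (x - a) ^ Suc n)
        = (v x - a) / (x - a)"
      using ne du
    proof eventually_elim
      case (elim x)
      have "(A / y ^ Suc (Suc n)) / (B / y ^ Suc n) = A / B / y" if "y \<noteq> 0" for A B y :: real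
        using that by simp
      moreover have "(v x - a) / (x - a) = 1 - (u x - x) / (deriv u x - 1) / (x - a)"
        unfolding v_off[OF elim] diff_divide_distrib[of "x - a"] using elim by simp
      ultimately show ?case
        using elim(1) by (metis right_minus_eq)
    qed
  qed
  have v_a: "v a = a"
    by (simp add: v_def v_fun_def)
  have "(v has_real_derivative p) (at a)"
    using quot by (simp add: has_field_derivative_iff v_a)
  then have dv_a: "deriv v a = p"
    by (rule DERIV_imp_deriv)

  have dv: "\<forall>\<^sub>F x in at a. (v has_real_derivative
      (u x - x) * deriv (deriv u) x / (deriv u x - 1) ^ 2) (at x)"
    using ne der du unfolding v_def by eventually_elim (rule v_fun_has_derivative_off)
  have "((\<lambda>x. ((u x - x) / (x - a) ^ Suc (Suc n)) * (deriv (deriv u) x / (x - a) ^ n)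
        / ((deriv u x - 1) / (x - a) ^ Suc n) ^ 2)
      \<longlongrightarrow> L / real (Suc n) / real (Suc (Suc n)) * L / (L / real (Suc n)) ^ 2) (at a)"
    by (intro tendsto_intros lim0 lim1 lim2) (use \<open>L \<noteq> 0\<close> in simp)
  also have "L / real (Suc n) / real (Suc (Suc n)) * L / (L / real (Suc n)) ^ 2 = p"
    using \<open>L \<noteq> 0\<close> by (simp add: p_def power2_eq_square del: of_nat_Suc)
  finally have "(deriv v \<longlongrightarrow> p) (at a)"
  proof (rule Lim_transform_eventually)
    \<comment> \<open>The powers balance because (n + 2) + n = 2 (n + 1).\<close>
    have cancel: "A / y ^ Suc (Suc n) * (C / y ^ n) / (B / y ^ Suc n) ^ 2 = A * C / B ^ 2"
      if "y \<noteq> 0" for A B C y :: real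
    proof -
      have "y ^ Suc (Suc n) * y ^ n = (y ^ Suc n) ^ 2"
        by (simp add: power2_eq_square)
      then show ?thesis
        using that by (simp add: power_divide del: power_Suc)
    qed
    show "\<forall>\<^sub>F x in at a. ((u x - x) / (x - a) ^ Suc (Suc n)) * (deriv (deriv u) x / (x - a) ^ n)
        / ((deriv u x - 1) / (x - a) ^ Suc n) ^ 2 = deriv v x"
      using ne dv
    proof eventually_elim
      case (elim x)
      then show ?case
        by (simp only: cancel DERIV_imp_deriv right_minus_eq not_False_eq_True)
    qed
  qed
  then have dv_ne: "\<forall>\<^sub>F x in at a. deriv v x \<noteq> 1"
    using \<open>p \<noteq> 1\<close> by (rule tendsto_imp_eventually_ne)
  have w_iff: "\<forall>\<^sub>F x in at a. w_fun u a x = a \<longleftrightarrow> v x - a = (x - a) * deriv v x"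
    using dv_ne unfolding v_def by eventually_elim (rule w_fun_eq_iff)
  \<comment> \<open>The kernel condition includes the point \<open>a\<close> itself; settling it
    here leaves only a punctured neighbourhood to study.\<close>
  have w_a: "w_fun u a a = a"
    using \<open>p \<noteq> 1\<close> dv_a w_fun_eq_iff[of u a a] by (simp add: v_def v_fun_def)

  have affine_iff: "(\<forall>\<^sub>F x in nhds a. v x = (1 - p) * a + p * x) \<longleftrightarrow>
      (\<forall>\<^sub>F x in at a. v x - a = p * (x - a))"
    unfolding eventually_nhds_conv_at by (simp add: v_a algebra_simps)
  have "in_kernel_w u a \<longleftrightarrow> (\<forall>\<^sub>F x in at a. w_fun u a x = a)"
    unfolding in_kernel_w_def eventually_nhds_conv_at by (simp add: w_a)
  also have "\<dots> \<longleftrightarrow> (\<forall>\<^sub>F x in at a. v x - a = (x - a) * deriv v x)"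
    by (rule eventually_cong[OF w_iff]) simp
  also have "\<dots> \<longleftrightarrow> (\<forall>\<^sub>F x in at a. v x - a = p * (x - a))"
  proof
    assume "\<forall>\<^sub>F x in at a. v x - a = (x - a) * deriv v x"
    \<comment> \<open>The numerator in the quotient rule is the difference of the two sides of the
      assumed equation.\<close>
    then have "\<forall>\<^sub>F x in at a. ((\<lambda>x. (v x - a) / (x - a)) has_real_derivative 0) (at x)"
      using ne dv
    proof eventually_elim
      case (elim x)
      then have "(v has_real_derivative deriv v x) (at x)"
        by (simp add: DERIV_imp_deriv)
      then have "((\<lambda>x. (v x - a) / (x - a)) has_real_derivative
          (deriv v x * (x - a) - (v x - a)) / (x - a) ^ 2) (at x)"
        using elim(2) by (auto intro!: derivative_eq_intros simp: power2_eq_square)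
      then show ?case
        using elim(1) by (simp add: mult.commute)
    qed
    from eventually_const_if_deriv_zero[OF this quot] ne
    show "\<forall>\<^sub>F x in at a. v x - a = p * (x - a)"
      by eventually_elim (simp add: field_simps)
  next
    assume "\<forall>\<^sub>F x in at a. v x - a = p * (x - a)"
    then have "\<forall>\<^sub>F x in nhds a. v x = (1 - p) * a + p * x"
      using affine_iff by simp
    \<comment> \<open>Equality at a point says nothing about derivatives; equality near each nearby
      point does.\<close>
    then have "\<forall>\<^sub>F x in nhds a. \<forall>\<^sub>F y in nhds x. v y = (1 - p) * a + p * y"
      by (simp add: eventually_eventually)
    then have "\<forall>\<^sub>F x in nhds a. v x - a = (x - a) * deriv v x"
    proof eventually_elim
      case (elim x)
      have "deriv v x = deriv (\<lambda>y. (1 - p) * a + p * y) x"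
        using elim by (intro deriv_cong_ev) auto
      also have "\<dots> = p"
        by (intro DERIV_imp_deriv) (auto intro!: derivative_eq_intros)
      finally show ?case
        using eventually_nhds_x_imp_x[OF elim] by (simp add: algebra_simps)
    qed
    then show "\<forall>\<^sub>F x in at a. v x - a = (x - a) * deriv v x"
      by (simp add: eventually_nhds_conv_at)
  qed
  finally show ?thesis
    using affine_iff unfolding dv_a[unfolded v_def] by (simp add: v_def)
qed

theorem lemma1:
  fixes m :: nat and u :: "real \<Rightarrow> real" and D :: "real set" and xs :: real
  assumes "m \<ge> 2"
    and "open D" and "xs \<in> D"
    and "continuously_differentiable_on m u D"
    and "xs isolated_in {x \<in> D. u x = x}"
    and "u xs = xs"
    and "deriv u xs = 1"
    and "\<forall>j. 2 \<le> j \<and> j \<le> m - 1 \<longrightarrow> (deriv ^^ j) u xs = 0"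
    and "(deriv ^^ m) u xs \<noteq> 0"
  shows "in_kernel_w u xs \<longleftrightarrow>
    (\<forall>\<^sub>F x in nhds xs. v_fun u xs x =
       (1 - deriv (v_fun u xs) xs) * xs + deriv (v_fun u xs) xs * x)"
proof -
  obtain n where m: "m = Suc (Suc n)"
    using \<open>m \<ge> 2\<close> by (metis add_2_eq_Suc le_Suc_ex)
  have shift: "(deriv ^^ j) (deriv (deriv u)) = (deriv ^^ Suc (Suc j)) u" for j
    by (simp add: funpow_swap1)
  have diff: "(deriv ^^ j) u field_differentiable at x" if "j < m" "x \<in> D" for j x
    using assms(4) that by (simp add: continuously_differentiable_on_def)
  have diff0: "u field_differentiable at x" and diff1: "deriv u field_differentiable at x"
    if "x \<in> D" for x
    using diff[of 0 x] diff[of 1 x] that m by simp_all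
  \<comment> \<open>The leading coefficient of u'' at \<open>xs\<close>, whose order of vanishing
    there is n = m - 2.\<close>
  define L where "L = (deriv ^^ m) u xs / fact n"
  \<comment> \<open>Taylor is applied to u'' because subtracting the identity changes only u and u';
    this avoids iterated derivatives of u - x.\<close>
  have "((\<lambda>x. deriv (deriv u) x / (x - xs) ^ n) \<longlongrightarrow>
      (deriv ^^ n) (deriv (deriv u)) xs / fact n) (at xs)"
  proof (rule tendsto_div_power_iterated_deriv[OF assms(2,3)]; unfold shift)
    show "\<forall>j<n. \<forall>x\<in>D. (deriv ^^ Suc (Suc j)) u field_differentiable at x"
      using diff m by blast
    show "isCont ((deriv ^^ Suc (Suc n)) u) xs"
      using assms(2-4) m continuous_on_eq_continuous_at
      unfolding continuously_differentiable_on_def by blast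
    show "\<forall>j<n. (deriv ^^ Suc (Suc j)) u xs = 0"
      using assms(8) m by (auto simp del: funpow.simps)
  qed
  then have lim2: "((\<lambda>x. deriv (deriv u) x / (x - xs) ^ n) \<longlongrightarrow> L) (at xs)"
    by (simp only: shift L_def m)
  have inD: "\<forall>\<^sub>F x in at xs. x \<in> D"
    using assms(2,3) by (rule eventually_at_in_open')
  \<comment> \<open>Two L'Hopital steps recover the lower orders; u' = 1 and u = x at
    \<open>xs\<close> supply the vanishing values.\<close>
  have lim1: "((\<lambda>x. (deriv u x - 1) / (x - xs) ^ Suc n) \<longlongrightarrow> L / real (Suc n)) (at xs)"
  proof (rule tendsto_div_power_Suc[OF _ _ _ lim2])
    show "\<forall>\<^sub>F x in at xs. ((\<lambda>x. deriv u x - 1) has_real_derivative deriv (deriv u) x) (at x)"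
      using inD by eventually_elim
        (auto intro!: derivative_eq_intros field_differentiable_derivI[OF diff1])
    show "isCont (\<lambda>x. deriv u x - 1) xs"
      using field_differentiable_imp_continuous_at[OF diff1] assms(3) by (intro continuous_intros) auto
  qed (simp add: assms)
  have lim0: "((\<lambda>x. (u x - x) / (x - xs) ^ Suc (Suc n)) \<longlongrightarrow>
      L / real (Suc n) / real (Suc (Suc n))) (at xs)"
  proof (rule tendsto_div_power_Suc[OF _ _ _ lim1])
    show "\<forall>\<^sub>F x in at xs. ((\<lambda>x. u x - x) has_real_derivative deriv u x - 1) (at x)"
      using inD by eventually_elim
        (auto intro!: derivative_eq_intros field_differentiable_derivI[OF diff0])
    show "isCont (\<lambda>x. u x - x) xs"
      using field_differentiable_imp_continuous_at[OF diff0] assms(3) by (intro continuous_intros) auto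
  qed (simp add: assms)
  show ?thesis
  proof (rule kernel_iff_v_affine[OF _ _ lim0 lim1 lim2])
    show "\<forall>\<^sub>F x in at xs. u field_differentiable at x"
      "\<forall>\<^sub>F x in at xs. deriv u field_differentiable at x"
      using inD by (auto elim!: eventually_mono simp: diff0 diff1)
    show "L \<noteq> 0"
      using assms(9) by (simp add: L_def)
  qed
qed

end
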